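(* Let $D \subset \mathbb{C}$ be a bounded domain. Then the density $\eta_D$ of the Hurwitz metric is continuous on $D$. Furthermore, if $p \in \partial D$ is a $C^2$-smooth boundary point, then $$\eta_D(z) \approx \frac{1}{\operatorname{dist}(z,\partial D)}$$ for $z \in D$ close to $p$; that is, there are a neighbourhood $V$ of $p$ and a constant $C>1$ such that $C^{-1} \le \eta_D(z)\operatorname{dist}(z,\partial D) \le C$ for all $z \in V \cap D$.
   Context: $C^2$-smooth boundary point $p\in\partial D$: there are a neighbourhood $U$ of $p$ and a $C^2$-smooth function $\psi : U \to \mathbb{R}$ with $U \cap D = \{\psi<0\}$, $U \cap \partial D = \{\psi = 0\}$ and $d\psi \ne 0$ on $U \cap \partial D$. Hurwitz metric: let $\mathbb{D}$ be the unit disc and $\mathbb{D}^* = \mathbb{D}\setminus\{0\}$. For $a \in D$, let $\mathcal{O}^*(a,D)$ be the set of holomorphic maps $f : \mathbb{D} \to D$ with $f(0)=a$, $f'(0)>0$ and $f(z) \ne a$ for all $z \in \mathbb{D}^*$. Set $r_D(a) = \sup\{f'(0) : f \in \mathcal{O}^*(a,D)\}$ and $\eta_D(a) = 1/r_D(a)$. The Hurwitz metric is $\eta_D(z)|dz|$. *)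

theory Defs
  imports "HOL-Analysis.Analysis"
begin

definition planar_domain :: "complex set \<Rightarrow> bool" where
  "planar_domain D \<longleftrightarrow> open D \<and> connected D \<and> D \<noteq> {}"

(* Twice continuously Frechet differentiable. Meant for open U, so that the values of
   g outside U play no role; continuity of g and g1 is implied by differentiability. *)
definition C2_on :: "'a::real_normed_vector set \<Rightarrow> ('a \<Rightarrow> 'b::real_normed_vector) \<Rightarrow> bool" where
  "C2_on U g \<longleftrightarrow>
     (\<exists>(g1 :: 'a \<Rightarrow> 'a \<Rightarrow>\<^sub>L 'b) (g2 :: 'a \<Rightarrow> 'a \<Rightarrow>\<^sub>L ('a \<Rightarrow>\<^sub>L 'b)).
        (\<forall>x\<in>U. (g has_derivative blinfun_apply (g1 x)) (at x)) \<and>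
        (\<forall>x\<in>U. (g1 has_derivative blinfun_apply (g2 x)) (at x)) \<and>
        continuous_on U g2)"

definition C2_boundary_point :: "complex set \<Rightarrow> complex \<Rightarrow> bool" where
  "C2_boundary_point D p \<longleftrightarrow>
     p \<in> frontier D \<and>
     (\<exists>U (\<psi> :: complex \<Rightarrow> real).
        open U \<and> p \<in> U \<and> C2_on U \<psi> \<and>
        U \<inter> D = {x \<in> U. \<psi> x < 0} \<and>
        U \<inter> frontier D = {x \<in> U. \<psi> x = 0} \<and>
        (\<forall>x \<in> U \<inter> frontier D. frechet_derivative \<psi> (at x) \<noteq> (\<lambda>_. 0)))"

definition hurwitz_maps :: "complex \<Rightarrow> complex set \<Rightarrow> (complex \<Rightarrow> complex) set" where
  "hurwitz_maps a D =
     {f. f holomorphic_on ball 0 1 \<and> f ` ball 0 1 \<subseteq> D \<and> f 0 = a \<and>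
         deriv f 0 \<in> \<real> \<and> Re (deriv f 0) > 0 \<and>
         (\<forall>z \<in> ball 0 1 - {0}. f z \<noteq> a)}"

(* The supremum is taken in the reals. For a bounded domain D and a in D it is a genuine
   one: the set contains the radius of any disc about a inside D, and is bounded above
   by Cauchy's inequality. *)
definition hurwitz_radius :: "complex set \<Rightarrow> complex \<Rightarrow> real" where
  "hurwitz_radius D a = Sup {Re (deriv f 0) | f. f \<in> hurwitz_maps a D}"

definition hurwitz_density :: "complex set \<Rightarrow> complex \<Rightarrow> real" where
  "hurwitz_density D a = 1 / hurwitz_radius D a"

end

theory Submission
  imports Defs "HOL-Complex_Analysis.Complex_Analysis"
begin

text \<open>The map \<open>z \<mapsto> a + dist(a, \<partial>D) z\<close> gives \<open>\<eta> \<cdot> dist \<le> 1\<close>. Conversely, a \<open>C\<^sup>2\<close> boundary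
  admits exterior discs of uniform radius \<open>\<rho>\<close>; if \<open>D\<close> avoids a disc centred at \<open>c\<close> of radius \<open>\<rho>\<close>,
  Schwarz--Pick for \<open>\<rho> / (f - c)\<close> gives \<open>f'(0) \<le> (\<bar>a - c\<bar>\<^sup>2 - \<rho>\<^sup>2) / \<rho>\<close>, which is comparable to
  \<open>\<bar>a - c\<bar> - \<rho>\<close>. The Hurwitz radius \<open>1 / \<eta>\<close> is lower semicontinuous because a competitor \<open>f\<close> at \<open>a\<close> yields
  the competitor \<open>f(tz) + (b - a)\<close> at nearby \<open>b\<close>, with \<open>t < 1\<close> close to \<open>1\<close>,
  and upper semicontinuous because limits of competitors are competitors, by the theorems of Montel and Hurwitz.\<close>

section \<open>Schwarz--Pick and the bound from an omitted disc\<close>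

text \<open>Composing with the Moebius function that sends \<open>w = g 0\<close> to 0 reduces this
  to the Schwarz lemma, since that function has derivative \<open>1 / (1 - (norm w)\<^sup>2)\<close>
  at \<open>w\<close>.\<close>

lemma Schwarz_Pick_deriv_0:
  assumes holg: "g holomorphic_on ball 0 1" and no: "\<And>z. norm z < 1 \<Longrightarrow> norm (g z) < 1"
  shows "norm (deriv g 0) \<le> 1 - (norm (g 0))\<^sup>2"
proof -
  define w where "w = g 0"
  have w: "norm w < 1" using no[of 0] by (simp add: w_def)
  define d :: complex where "d = of_real (1 - (norm w)\<^sup>2)"
  have cw: "1 - cnj w * w = d"
    unfolding d_def by (simp only: of_real_diff of_real_1 complex_norm_square mult.commute[of w])
  have pos: "1 - (norm w)\<^sup>2 > 0" using w by (simp add: power_less_one_iff abs_square_less_1)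
  then have d0: "d \<noteq> 0" by (simp add: d_def del: of_real_diff)
  define h where "h = Moebius_function 0 w \<circ> g"
  have "h holomorphic_on ball 0 1"
    unfolding h_def
    by (rule holomorphic_on_compose_gen[OF holg Moebius_function_holomorphic[OF w]]) (use no in auto)
  moreover have "h 0 = 0" by (simp add: h_def w_def Moebius_function_eq_zero)
  moreover have "norm (h z) < 1" if "norm z < 1" for z
    using Moebius_function_norm_lt_1[OF w no[OF that]] by (simp add: h_def)
  ultimately have le: "norm (deriv h 0) \<le> 1"
    using Schwarz_Lemma(2)[of h 0] by auto
  have dg: "(g has_field_derivative deriv g 0) (at 0)"
    using holomorphic_derivI[OF holg, of 0] by auto
  have "(h has_field_derivative deriv g 0 / d) (at 0)"
    unfolding h_def o_def Moebius_function_simple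
    by (rule derivative_eq_intros dg refl | simp add: cw d0 flip: w_def)+
  then have "deriv h 0 = deriv g 0 / d" by (rule DERIV_imp_deriv)
  with le have "norm (deriv g 0) \<le> norm d"
    using d0 by (simp add: norm_divide divide_simps)
  also have "norm d = 1 - (norm w)\<^sup>2" using pos by (simp only: d_def norm_of_real)
  finally show ?thesis by (simp add: w_def)
qed

text \<open>Inversion in the omitted disc turns \<open>f\<close> into a self-map \<open>g\<close> of
  the unit disc, with \<open>norm (g 0) = \<rho> / dist a c\<close> and \<open>norm (deriv g 0) =
  \<rho> * norm (deriv f 0) / (dist a c)\<^sup>2\<close>. Schwarz--Pick then rearranges to the
  bound.\<close>

lemma hurwitz_map_deriv_le_exterior_disc:
  assumes f: "f \<in> hurwitz_maps a D" and rho: "\<rho> > 0" and disj: "cball c \<rho> \<inter> D = {}"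
  shows "Re (deriv f 0) \<le> ((dist a c)\<^sup>2 - \<rho>\<^sup>2) / \<rho>"
proof -
  have holf: "f holomorphic_on ball 0 1" and f0: "f 0 = a"
    and fD: "\<And>z. norm z < 1 \<Longrightarrow> f z \<in> D"
    using f by (auto simp: hurwitz_maps_def)
  have far: "norm (f z - c) > \<rho>" if "norm z < 1" for z
    using fD[OF that] disj by (force simp: dist_norm norm_minus_commute)
  then have ne: "f z - c \<noteq> 0" if "norm z < 1" for z
    using that rho by force
  define g where "g = (\<lambda>z. of_real \<rho> / (f z - c))"
  have "g holomorphic_on ball 0 1"
    unfolding g_def by (intro holomorphic_intros holf) (use ne in auto)
  moreover have "norm (g z) < 1" if "norm z < 1" for z
    using far[OF that] rho by (simp add: g_def norm_divide divide_simps)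
  ultimately have le: "norm (deriv g 0) \<le> 1 - (norm (g 0))\<^sup>2"
    by (rule Schwarz_Pick_deriv_0)
  have df: "(f has_field_derivative deriv f 0) (at 0)"
    using holomorphic_derivI[OF holf, of 0] by auto
  have ac: "a \<noteq> c" using ne[of 0] f0 by simp
  have "(g has_field_derivative - (of_real \<rho> * deriv f 0) / (a - c)\<^sup>2) (at 0)"
    unfolding g_def
    by (rule derivative_eq_intros df refl | simp add: f0 ac power2_eq_square del: mult_eq_0_iff)+
  then have "norm (deriv g 0) = \<rho> * norm (deriv f 0) / (dist a c)\<^sup>2"
    using rho by (simp add: DERIV_imp_deriv norm_divide norm_mult norm_power dist_norm)
  moreover have "norm (g 0) = \<rho> / dist a c"
    using rho by (simp add: g_def f0 norm_divide dist_norm)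
  moreover have "dist a c > 0" using ac by simp
  ultimately have "\<rho> * norm (deriv f 0) \<le> (dist a c)\<^sup>2 - \<rho>\<^sup>2"
    using le by (simp add: power_divide pos_divide_le_eq left_diff_distrib)
  then have "norm (deriv f 0) \<le> ((dist a c)\<^sup>2 - \<rho>\<^sup>2) / \<rho>"
    using rho by (simp add: field_simps)
  then show ?thesis using complex_Re_le_cmod[of "deriv f 0"] by linarith
qed

section \<open>Elementary bounds on the Hurwitz radius\<close>

lemma hurwitz_radius_bdd_above:
  assumes "bounded D"
  shows "bdd_above {Re (deriv f 0) | f. f \<in> hurwitz_maps a D}"
proof -
  obtain B where B: "\<And>x. x \<in> D \<Longrightarrow> norm x < B"
    using assms bounded_pos_less by metis
  have "Re (deriv f 0) \<le> 2 * B" if f: "f \<in> hurwitz_maps a D" for f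
  proof -
    have holf: "f holomorphic_on ball 0 1" and fD: "f ` ball 0 1 \<subseteq> D"
      using f by (auto simp: hurwitz_maps_def)
    \<comment> \<open>Cauchy's inequality wants continuity up to the closed disc, so it is applied
      on radius 1/2; this costs the factor 2.\<close>
    have "cmod ((deriv ^^ 1) f 0) \<le> fact 1 * B / (1/2) ^ 1"
    proof (rule Cauchy_higher_deriv_bound)
      show "f holomorphic_on ball 0 (1/2)"
        by (rule holomorphic_on_subset[OF holf]) auto
      show "continuous_on (cball 0 (1/2)) f"
        by (rule continuous_on_subset[OF holomorphic_on_imp_continuous_on[OF holf]]) auto
      show "f w \<in> ball 0 B" if "w \<in> ball 0 (1/2)" for w
        using fD B that by force
    qed auto
    then show ?thesis using complex_Re_le_cmod[of "deriv f 0"] by simp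
  qed
  then show ?thesis by (auto intro!: bdd_aboveI)
qed

lemma hurwitz_radius_upper:
  assumes "bounded D" "f \<in> hurwitz_maps a D"
  shows "Re (deriv f 0) \<le> hurwitz_radius D a"
  unfolding hurwitz_radius_def
  by (rule cSup_upper[OF _ hurwitz_radius_bdd_above[OF assms(1)]]) (use assms in auto)

lemma affine_in_hurwitz_maps:
  assumes "\<delta> > 0" "ball a \<delta> \<subseteq> D"
  shows "(\<lambda>z. a + of_real \<delta> * z) \<in> hurwitz_maps a D"
    and "deriv (\<lambda>z. a + of_real \<delta> * z) 0 = of_real \<delta>"
proof -
  show d: "deriv (\<lambda>z. a + of_real \<delta> * z) 0 = of_real \<delta>"
    by (rule DERIV_imp_deriv) (rule derivative_eq_intros refl | simp)+
  have "a + of_real \<delta> * z \<in> D" if "norm z < 1" for z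
    using assms that by (intro subsetD[OF assms(2)]) (simp add: dist_norm norm_mult)
  then show "(\<lambda>z. a + of_real \<delta> * z) \<in> hurwitz_maps a D"
    using assms d by (auto simp: hurwitz_maps_def intro!: holomorphic_intros)
qed

lemma hurwitz_maps_nonempty:
  assumes "open D" "a \<in> D"
  obtains f where "f \<in> hurwitz_maps a D"
  using assms affine_in_hurwitz_maps(1) open_contains_ball by metis

lemma inradius_le_hurwitz_radius:
  assumes "bounded D" "\<delta> > 0" "ball a \<delta> \<subseteq> D"
  shows "\<delta> \<le> hurwitz_radius D a"
  using hurwitz_radius_upper[OF assms(1) affine_in_hurwitz_maps(1)[OF assms(2,3)]]
  by (simp add: affine_in_hurwitz_maps(2)[OF assms(2,3)])

lemma hurwitz_radius_pos:
  assumes "open D" "bounded D" "a \<in> D"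
  shows "hurwitz_radius D a > 0"
  using assms inradius_le_hurwitz_radius open_contains_ball
  by (metis less_le_trans)

lemma less_hurwitz_radiusE:
  assumes "open D" "a \<in> D" "l < hurwitz_radius D a"
  obtains f where "f \<in> hurwitz_maps a D" "l < Re (deriv f 0)"
proof -
  obtain f0 where "f0 \<in> hurwitz_maps a D" using hurwitz_maps_nonempty assms by metis
  then have "{Re (deriv f 0) | f. f \<in> hurwitz_maps a D} \<noteq> {}" by blast
  from less_cSupD[OF this assms(3)[unfolded hurwitz_radius_def]] show ?thesis
    using that by blast
qed

lemma hurwitz_radius_le_exterior_disc:
  assumes "open D" "a \<in> D" "\<rho> > 0" "cball c \<rho> \<inter> D = {}"
  shows "hurwitz_radius D a \<le> ((dist a c)\<^sup>2 - \<rho>\<^sup>2) / \<rho>"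
  using hurwitz_map_deriv_le_exterior_disc[OF _ assms(3,4)] less_hurwitz_radiusE[OF assms(1,2)]
  by (metis not_le)

section \<open>Lower semicontinuity by perturbing a competitor\<close>

lemma shrink_translate_in_hurwitz_maps:
  assumes D: "open D" and f: "f \<in> hurwitz_maps a D" and t: "0 < t" "t < 1"
  shows "\<forall>\<^sub>F b in nhds a. (\<lambda>z. f (of_real t * z) + (b - a)) \<in> hurwitz_maps b D"
    and "deriv (\<lambda>z. f (of_real t * z) + (b - a)) 0 = of_real t * deriv f 0"
proof -
  have holf: "f holomorphic_on ball 0 1" and fD: "f ` ball 0 1 \<subseteq> D" and f0: "f 0 = a"
    and re: "deriv f 0 \<in> \<real>" "Re (deriv f 0) > 0"
    and inj0: "\<And>z. norm z < 1 \<Longrightarrow> z \<noteq> 0 \<Longrightarrow> f z \<noteq> a"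
    using f by (auto simp: hurwitz_maps_def)
  \<comment> \<open>The base point is left as \<open>of_real t * 0\<close> to match the chain
    rule.\<close>
  have df: "(f has_field_derivative deriv f 0) (at (of_real t * 0))"
    using holomorphic_derivI[OF holf, of 0] by auto
  have dt: "((\<lambda>z. of_real t * z) has_field_derivative of_real t) (at (0::complex))"
    by (rule derivative_eq_intros refl | simp)+
  have der: "deriv (\<lambda>z. f (of_real t * z) + (b - a)) 0 = of_real t * deriv f 0" for b
    using DERIV_add[OF DERIV_chain2[OF df dt] DERIV_const[of "b - a"]]
    by (intro DERIV_imp_deriv) (simp add: mult.commute)
  then show "deriv (\<lambda>z. f (of_real t * z) + (b - a)) 0 = of_real t * deriv f 0" .
  have "compact (f ` cball 0 t)"
    using t by (intro compact_continuous_image compact_cball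
        continuous_on_subset[OF holomorphic_on_imp_continuous_on[OF holf]]) auto
  moreover have "f ` cball 0 t \<subseteq> D" using fD t by force
  ultimately obtain e where e: "e > 0" "(\<Union>x\<in>f ` cball 0 t. ball x e) \<subseteq> D"
    using compact_subset_open_imp_ball_epsilon_subset[OF _ D] by metis
  show "\<forall>\<^sub>F b in nhds a. (\<lambda>z. f (of_real t * z) + (b - a)) \<in> hurwitz_maps b D"
    unfolding eventually_nhds_metric
  proof (intro exI[of _ e] conjI allI impI e(1))
    fix b assume b: "dist b a < e"
    have tz: "norm (of_real t * z) < 1" if "norm z < 1" for z :: complex
      using that t mult_strict_mono'[of t 1 "norm z" 1] by (simp add: norm_mult)
    have "(\<lambda>z. f (of_real t * z) + (b - a)) holomorphic_on ball 0 1"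
      by (intro holomorphic_intros holomorphic_on_compose_gen[OF _ holf, unfolded o_def])
        (use tz in auto)
    moreover have "f (of_real t * z) + (b - a) \<in> D" if "norm z < 1" for z
    proof -
      have "of_real t * z \<in> cball 0 t" using that t by (simp add: norm_mult mult_left_le)
      moreover have "f (of_real t * z) + (b - a) \<in> ball (f (of_real t * z)) e"
        using b by (simp add: dist_norm norm_minus_commute)
      ultimately show ?thesis using e(2) by blast
    qed
    moreover have "f (of_real t * z) + (b - a) \<noteq> b" if "norm z < 1" "z \<noteq> 0" for z
      using inj0[OF tz[OF that(1)]] that t by auto
    ultimately show "(\<lambda>z. f (of_real t * z) + (b - a)) \<in> hurwitz_maps b D"
      using re t f0 der by (auto simp: hurwitz_maps_def)
  qed
qed

lemma hurwitz_radius_lower_semicontinuous: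
  assumes "open D" "bounded D" "a \<in> D" "l < hurwitz_radius D a"
  shows "\<forall>\<^sub>F b in nhds a. l < hurwitz_radius D b"
proof -
  obtain f where f: "f \<in> hurwitz_maps a D" and lf: "l < Re (deriv f 0)"
    using less_hurwitz_radiusE assms by metis
  \<comment> \<open>The strict inequality \<open>l < Re (deriv f 0)\<close> leaves room for the
    factor \<open>t\<close> lost by shrinking.\<close>
  have "((\<lambda>t. t * Re (deriv f 0)) \<longlongrightarrow> 1 * Re (deriv f 0)) (at_left 1)"
    by (intro tendsto_intros)
  then have "\<forall>\<^sub>F t in at_left 1. l < t * Re (deriv f 0)"
    using lf by (auto dest: order_tendstoD(1))
  moreover have "\<forall>\<^sub>F t::real in at_left 1. 0 < t \<and> t < 1"
    by (rule eventually_at_leftI[of 0]) auto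
  ultimately obtain t where t: "0 < t" "t < 1" "l < t * Re (deriv f 0)"
    using eventually_happens'[OF _ eventually_conj] by (metis (mono_tags, lifting) trivial_limit_at_left_real)
  show ?thesis
    using shrink_translate_in_hurwitz_maps(1)[OF assms(1) f t(1,2)]
  proof eventually_elim
    case (elim b)
    from hurwitz_radius_upper[OF assms(2) this] t(3) show ?case
      by (simp add: shrink_translate_in_hurwitz_maps(2)[OF assms(1) f t(1,2)])
  qed
qed

section \<open>Upper semicontinuity by normal families\<close>

text \<open>The positive lower bound \<open>m\<close> on the derivatives passes to the limit and
  rules out a constant \<open>g\<close>. Hurwitz's theorem then shows that omitted values stay
  omitted, both those outside \<open>D\<close> and the base point on the punctured disc.\<close>

lemma hurwitz_maps_limit:
  assumes D: "open D" and a: "a \<in> D"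
    and f: "\<And>n. f n \<in> hurwitz_maps (b n) D"
    and lim: "b \<longlonglongrightarrow> a"
    and holg: "g holomorphic_on ball 0 1"
    and ul: "\<And>K. compact K \<Longrightarrow> K \<subseteq> ball 0 1 \<Longrightarrow> uniform_limit K f g sequentially"
    and m: "m > 0" "\<And>n. m \<le> Re (deriv (f n) 0)"
  shows "g \<in> hurwitz_maps a D" and "m \<le> Re (deriv g 0)"
proof -
  have holf: "\<And>n. f n holomorphic_on ball 0 1" and fD: "\<And>n. f n ` ball 0 1 \<subseteq> D"
    and f0: "\<And>n. f n 0 = b n" and re: "\<And>n. deriv (f n) 0 \<in> \<real>"
    and inj0: "\<And>n z. norm z < 1 \<Longrightarrow> z \<noteq> 0 \<Longrightarrow> f n z \<noteq> b n"
    using f by (auto simp: hurwitz_maps_def)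
  have "uniform_limit (cball 0 (1/2)) f g sequentially" by (rule ul) auto
  then have ul2: "uniform_limit (ball 0 (1/2)) f g sequentially"
    by (rule uniform_limit_on_subset) auto
  have "((\<lambda>n. (deriv ^^ 1) (f n) 0) \<longlongrightarrow> (deriv ^^ 1) g 0) sequentially"
    by (rule higher_deriv_complex_uniform_limit[OF ul2])
      (auto intro!: always_eventually holomorphic_on_subset[OF holf])
  then have dlim: "(\<lambda>n. deriv (f n) 0) \<longlonglongrightarrow> deriv g 0" by simp
  have dre: "deriv g 0 \<in> \<real>"
    by (rule closed_sequentially[OF closed_complex_Reals _ dlim]) (use re in auto)
  show dge: "m \<le> Re (deriv g 0)"
    by (rule tendsto_lowerbound[OF tendsto_Re[OF dlim]]) (use m in auto)
  \<comment> \<open>By the identity theorem, constancy on any such \<open>S\<close> would spread to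
    the whole disc and force \<open>deriv g 0 = 0\<close>.\<close>
  have nonconst: "\<not> g constant_on S" if S: "open S" "S \<noteq> {}" "S \<subseteq> ball 0 1" for S
  proof
    assume "g constant_on S"
    then obtain k where k: "\<And>z. z \<in> S \<Longrightarrow> g z = k" by (auto simp: constant_on_def)
    have "g z = k" if "z \<in> ball 0 1" for z
      by (rule analytic_continuation_open[OF S(1) open_ball S(2) _ S(3) holg _ k that]) auto
    then have "\<forall>\<^sub>F z in nhds 0. g z = k"
      by (intro eventually_mono[OF eventually_nhds_in_open[of "ball 0 1"]]) auto
    then have "deriv g 0 = 0" by (simp add: deriv_cong_ev[of g "\<lambda>_. k"])
    then show False using dge m(1) by simp
  qed
  have g0: "g 0 = a"
  proof (rule LIMSEQ_unique)
    show "(\<lambda>n. f n 0) \<longlonglongrightarrow> g 0"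
      by (rule tendsto_uniform_limitI[OF ul2]) auto
    show "(\<lambda>n. f n 0) \<longlonglongrightarrow> a" using lim by (simp add: f0)
  qed
  \<comment> \<open>The omitted values \<open>k' n\<close> may vary with \<open>n\<close>: a
    constant sequence serves for points outside \<open>D\<close>, and \<open>b\<close> for the base
    points.\<close>
  have avoid: "g z \<noteq> k"
    if S: "open S" "connected S" "S \<subseteq> ball 0 1" and kn: "k' \<longlonglongrightarrow> k"
      and av: "\<And>n z. z \<in> S \<Longrightarrow> f n z \<noteq> k' n" and z: "z \<in> S" for S k k' z
  proof -
    have "g z - k \<noteq> 0"
    proof (rule Hurwitz_no_zeros[where \<F> = "\<lambda>n z. f n z - k' n" and g = "\<lambda>z. g z - k", OF S(1,2)])
      show "(\<lambda>z. f n z - k' n) holomorphic_on S" for n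
        by (intro holomorphic_intros holomorphic_on_subset[OF holf S(3)])
      show "(\<lambda>z. g z - k) holomorphic_on S"
        by (intro holomorphic_intros holomorphic_on_subset[OF holg S(3)])
      show "uniform_limit K (\<lambda>n z. f n z - k' n) (\<lambda>z. g z - k) sequentially"
        if "compact K" "K \<subseteq> S" for K
      proof (rule uniform_limit_minus[OF ul])
        show "uniform_limit K (\<lambda>n z. k' n) (\<lambda>z. k) sequentially"
          using kn by (auto simp: uniform_limit_iff tendsto_iff)
      qed (use that S in auto)
      have "\<not> g constant_on S" using nonconst[OF S(1) _ S(3)] z by blast
      then show "\<not> (\<lambda>z. g z - k) constant_on S"
        unfolding constant_on_def by (metis diff_eq_eq)
      show "f n z - k' n \<noteq> 0" if "z \<in> S" for n z using av[OF that] by simp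
    qed (rule z)
    then show ?thesis by simp
  qed
  have "g z \<in> D" if "z \<in> ball 0 1" for z
  proof (rule ccontr)
    assume "g z \<notin> D"
    \<comment> \<open>Every \<open>f n\<close> omits the point \<open>g z\<close> outside
      \<open>D\<close>, so \<open>g\<close> would have to omit its own value.\<close>
    then have "f n w \<noteq> g z" if "w \<in> ball 0 1" for n w
      using fD[of n] that by (metis image_subset_iff)
    from avoid[OF open_ball connected_ball order_refl tendsto_const this that] show False
      by simp
  qed
  \<comment> \<open>The origin is deleted because \<open>f n\<close> takes the value
    \<open>b n\<close> there; the remaining set is still connected, as Hurwitz's theorem
    demands.\<close>
  moreover have "g z \<noteq> a" if "z \<in> ball 0 1 - {0}" for z
  proof (rule avoid[OF _ _ _ lim _ that])
    show "connected (ball 0 1 - {0 :: complex})"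
      by (rule connected_open_delete) auto
  qed (use inj0 in auto)
  ultimately show "g \<in> hurwitz_maps a D"
    using holg g0 dre dge m(1) by (auto simp: hurwitz_maps_def)
qed

lemma hurwitz_radius_upper_semicontinuous:
  assumes D: "open D" "bounded D" and a: "a \<in> D" and u: "hurwitz_radius D a < u"
  shows "\<forall>\<^sub>F b in at a within D. hurwitz_radius D b < u"
proof (rule ccontr)
  assume "\<not> ?thesis"
  then have bad: "\<exists>x\<in>D. dist x a < e \<and> u \<le> hurwitz_radius D x" if "e > 0" for e
    using that unfolding eventually_at by (metis not_le)
  \<comment> \<open>The supremum at a bad point need not be attained, so a level strictly below
    \<open>u\<close> is used; competitors exceeding it do exist there.\<close>
  obtain m where m: "hurwitz_radius D a < m" "m < u" using dense u by blast
  have m0: "m > 0" using hurwitz_radius_pos[OF D a] m by linarith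
  have "\<exists>x f. x \<in> D \<and> dist x a < inverse (real (Suc n)) \<and> f \<in> hurwitz_maps x D \<and> m \<le> Re (deriv f 0)"
    for n
  proof -
    obtain x where x: "x \<in> D" "dist x a < inverse (real (Suc n))" "u \<le> hurwitz_radius D x"
      using bad[of "inverse (real (Suc n))"] by auto
    obtain f where "f \<in> hurwitz_maps x D" "m < Re (deriv f 0)"
      using less_hurwitz_radiusE[OF D(1) x(1), of m] m x(3) by auto
    with x show ?thesis by (metis less_imp_le)
  qed
  then obtain x f where xf: "\<And>n. x n \<in> D" "\<And>n. dist (x n) a < inverse (real (Suc n))"
    "\<And>n. f n \<in> hurwitz_maps (x n) D" "\<And>n. m \<le> Re (deriv (f n) 0)"
    by metis
  have "x \<longlonglongrightarrow> a"
    by (rule metric_tendsto_imp_tendsto[OF LIMSEQ_inverse_real_of_nat])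
      (use xf(2) in \<open>auto intro!: always_eventually less_imp_le\<close>)
  obtain B where B: "\<And>x. x \<in> D \<Longrightarrow> norm x \<le> B"
    using D(2) bounded_iff by metis
  have fn: "f n holomorphic_on ball 0 1" "f n ` ball 0 1 \<subseteq> D" for n
    using xf(3)[of n] by (auto simp: hurwitz_maps_def)
  obtain g r where g: "g holomorphic_on ball 0 1" "strict_mono (r :: nat \<Rightarrow> nat)"
    "\<And>K. compact K \<Longrightarrow> K \<subseteq> ball 0 1 \<Longrightarrow> uniform_limit K (f \<circ> r) g sequentially"
  \<comment> \<open>All the maps take values in the bounded set \<open>D\<close>, so one bound
    \<open>B\<close> serves every compact \<open>K\<close>.\<close>
  proof (rule Montel[of "ball 0 1" "range f" f])
    show "\<exists>B. \<forall>h\<in>range f. \<forall>z\<in>K. norm (h z) \<le> B" if "K \<subseteq> ball 0 1" for K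
      using fn(2) B that by (intro exI[of _ B]) blast
  qed (use fn in auto)
  have "(x \<circ> r) \<longlonglongrightarrow> a"
    using \<open>x \<longlonglongrightarrow> a\<close> g(2) by (rule LIMSEQ_subseq_LIMSEQ)
  from hurwitz_maps_limit[OF D(1) a _ this g(1) g(3) m0]
  have "g \<in> hurwitz_maps a D" "m \<le> Re (deriv g 0)" using xf by auto
  with hurwitz_radius_upper[OF D(2)] m show False by fastforce
qed

lemma continuous_on_hurwitz_density:
  assumes "open D" "bounded D"
  shows "continuous_on D (hurwitz_density D)"
proof -
  have "continuous_on D (hurwitz_radius D)"
    unfolding continuous_on
  proof (intro ballI order_tendstoI)
    fix a l assume "a \<in> D" "l < hurwitz_radius D a"
    then show "\<forall>\<^sub>F b in at a within D. l < hurwitz_radius D b"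
      unfolding eventually_at_filter
      by (rule eventually_mono[OF hurwitz_radius_lower_semicontinuous[OF assms]]) auto
  qed (rule hurwitz_radius_upper_semicontinuous[OF assms])
  moreover have "\<forall>a\<in>D. hurwitz_radius D a \<noteq> 0"
    using hurwitz_radius_pos[OF assms] by (metis less_irrefl)
  ultimately show ?thesis
    unfolding hurwitz_density_def by (intro continuous_intros)
qed

section \<open>Geometry near a smooth boundary point\<close>

text \<open>A ball is connected, so one that meets both \<open>D\<close> and its complement would
  contain a frontier point nearer than the distance allows.\<close>

lemma ball_infdist_frontier_subset:
  fixes a :: "'a::real_normed_vector"
  assumes "a \<in> D"
  shows "ball a (infdist a (frontier D)) \<subseteq> D"
proof (rule ccontr)
  let ?B = "ball a (infdist a (frontier D))"
  assume "\<not> ?B \<subseteq> D"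
  then obtain y where y: "y \<in> ?B" "y \<notin> D" by blast
  \<comment> \<open>The presence of \<open>y\<close> makes the radius positive. An empty frontier is
    covered too, as \<open>infdist\<close> is then 0 and the ball is empty.\<close>
  then have "a \<in> ?B" using zero_le_dist[of a y] by (simp del: zero_le_dist)
  with y have "?B \<inter> D \<noteq> {}" "?B - D \<noteq> {}" using assms by blast+
  then obtain x where "x \<in> ?B" "x \<in> frontier D"
    using connected_Int_frontier[OF connected_ball] by blast
  then show False using infdist_le[of x "frontier D" a] by auto
qed

text \<open>A bound on the second derivative near \<open>p\<close> makes the first derivative
  Lipschitz there, and a second use of the mean value inequality gives the quadratic remainder. One
  \<open>M\<close> serves all base points \<open>q\<close>, which later yields discs of one common
  radius.\<close>

lemma C2_on_Taylor_bound:
  fixes \<psi> :: "'a::real_normed_vector \<Rightarrow> 'b::real_normed_vector"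
  assumes C2: "C2_on U \<psi>" and U: "open U" "p \<in> U"
  obtains L :: "'a \<Rightarrow> 'a \<Rightarrow>\<^sub>L 'b" and M s where "s > 0" "M > 0" "ball p s \<subseteq> U" "continuous_on (ball p s) L"
    "\<And>x. x \<in> ball p s \<Longrightarrow> (\<psi> has_derivative blinfun_apply (L x)) (at x)"
    "\<And>x q. x \<in> ball p s \<Longrightarrow> q \<in> ball p s \<Longrightarrow>
       norm (\<psi> x - \<psi> q - blinfun_apply (L q) (x - q)) \<le> M * (norm (x - q))\<^sup>2"
proof -
  obtain L :: "'a \<Rightarrow> 'a \<Rightarrow>\<^sub>L 'b" and L2 where
    L: "\<And>x. x \<in> U \<Longrightarrow> (\<psi> has_derivative blinfun_apply (L x)) (at x)" and
    L2: "\<And>x. x \<in> U \<Longrightarrow> (L has_derivative blinfun_apply (L2 x)) (at x)" and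
    cont: "continuous_on U L2"
    using C2 unfolding C2_on_def by blast
  define M where "M = norm (L2 p) + 1"
  have M: "M > 0" by (simp add: M_def add_nonneg_pos)
  have "isCont L2 p" using cont U continuous_on_eq_continuous_at by blast
  then have "((\<lambda>x. norm (L2 x)) \<longlongrightarrow> norm (L2 p)) (nhds p)"
    by (intro tendsto_norm) (simp add: continuous_at tendsto_at_iff_tendsto_nhds)
  then have "\<forall>\<^sub>F x in nhds p. norm (L2 x) < M"
    by (rule order_tendstoD) (simp add: M_def)
  with eventually_nhds_in_open[OF U] have "\<forall>\<^sub>F x in nhds p. x \<in> U \<and> norm (L2 x) < M"
    by eventually_elim auto
  then obtain s where s: "s > 0" "\<And>x. dist x p < s \<Longrightarrow> x \<in> U \<and> norm (L2 x) < M"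
    unfolding eventually_nhds_metric by blast
  have sU: "ball p s \<subseteq> U" using s(2) by (auto simp: dist_commute)
  have Lip: "norm (L x - L q) \<le> M * norm (x - q)" if "x \<in> ball p s" "q \<in> ball p s" for x q
  proof (rule differentiable_bound[OF convex_ball _ _ that])
    fix y assume y: "y \<in> ball p s"
    show "(L has_derivative blinfun_apply (L2 y)) (at y within ball p s)"
      by (rule has_derivative_at_withinI[OF L2[OF subsetD[OF sU y]]])
    show "onorm (blinfun_apply (L2 y)) \<le> M"
      using s(2)[of y] y by (auto simp: norm_blinfun.rep_eq dist_commute)
  qed
  show ?thesis
  proof (rule that[OF s(1) M sU])
    show "continuous_on (ball p s) L"
      by (rule has_derivative_continuous_on, rule has_derivative_at_withinI, rule L2[OF subsetD[OF sU]])
    show "(\<psi> has_derivative blinfun_apply (L x)) (at x)" if "x \<in> ball p s" for x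
      by (rule L[OF subsetD[OF sU that]])
    fix x q assume x: "x \<in> ball p s" and q: "q \<in> ball p s"
    \<comment> \<open>On this convex set the Lipschitz bound gives
      \<open>norm (L y - L q) \<le> M * norm (x - q)\<close>, which supplies the second factor
      \<open>norm (x - q)\<close>.\<close>
    define S where "S = ball p s \<inter> cball q (norm (x - q))"
    have "norm ((\<psi> x - blinfun_apply (L q) x) - (\<psi> q - blinfun_apply (L q) q)) \<le> (M * norm (x - q)) * norm (x - q)"
    proof (rule differentiable_bound)
      show "convex S" by (simp add: S_def convex_Int)
      show "x \<in> S" "q \<in> S" using x q by (auto simp: S_def dist_norm norm_minus_commute)
      fix y assume y: "y \<in> S"
      show "((\<lambda>y. \<psi> y - blinfun_apply (L q) y) has_derivative blinfun_apply (L y - L q)) (at y within S)"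
        unfolding blinfun.diff_left
        using y L sU by (intro has_derivative_diff has_derivative_at_withinI[OF L] bounded_linear_imp_has_derivative
          blinfun.bounded_linear_right) (auto simp: S_def)
      have "norm (L y - L q) \<le> M * norm (y - q)" using Lip y q by (auto simp: S_def)
      also have "\<dots> \<le> M * norm (x - q)"
        using y M by (intro mult_left_mono) (auto simp: S_def dist_norm norm_minus_commute)
      finally show "onorm (blinfun_apply (L y - L q)) \<le> M * norm (x - q)"
        by (simp add: norm_blinfun.rep_eq)
    qed
    then show "norm (\<psi> x - \<psi> q - blinfun_apply (L q) (x - q)) \<le> M * (norm (x - q))\<^sup>2"
      by (simp add: blinfun.diff_right algebra_simps power2_eq_square)
  qed
qed

text \<open>Riesz representation, normalised to a unit vector; for \<open>L = 0\<close> any unit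
  vector will do. Applied to the derivative of a defining function, it yields the outward
  normal.\<close>

lemma linear_functional_direction:
  fixes L :: "'a::euclidean_space \<Rightarrow>\<^sub>L real"
  obtains n where "norm n = 1" "\<And>v. blinfun_apply L v = norm L * (n \<bullet> v)"
proof -
  define g where "g = (\<Sum>b\<in>Basis. blinfun_apply L b *\<^sub>R b)"
  have Lg: "blinfun_apply L v = g \<bullet> v" for v
  proof -
    have "blinfun_apply L v = blinfun_apply L (\<Sum>b\<in>Basis. (v \<bullet> b) *\<^sub>R b)"
      by (simp add: euclidean_representation)
    also have "\<dots> = g \<bullet> v"
      by (simp add: g_def blinfun.sum_right blinfun.scaleR_right inner_sum_left inner_commute[of v] mult.commute)
    finally show ?thesis .
  qed
  have "norm L = norm g"
  proof (rule norm_blinfun_eqI)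
    \<comment> \<open>The operator norm is attained at \<open>g\<close>; for \<open>g = 0\<close>
      the convention \<open>0 / 0 = 0\<close> keeps this true.\<close>
    show "norm g \<le> norm (blinfun_apply L g) / norm g"
      by (simp add: Lg flip: power2_norm_eq_inner) (simp add: power2_eq_square)
    show "norm (blinfun_apply L x) \<le> norm g * norm x" for x
      by (simp add: Lg Cauchy_Schwarz_ineq2)
  qed auto
  obtain e :: 'a where "norm e = 1" using vector_choose_size[of 1] by auto
  show ?thesis
  proof (cases "g = 0")
    case True
    then show ?thesis using that[OF \<open>norm e = 1\<close>] Lg \<open>norm L = norm g\<close> by simp
  next
    case False
    then show ?thesis
      by (intro that[of "g /\<^sub>R norm g"]) (auto simp: Lg \<open>norm L = norm g\<close>)
  qed
qed

text \<open>On a small disc touching the boundary at \<open>q\<close> from the outward side, the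
  linear term of the defining function dominates its quadratic remainder, so the function is
  nonnegative there.\<close>

lemma C2_boundary_point_exterior_disc:
  assumes "C2_boundary_point D p"
  obtains r \<rho> where "r > 0" "\<rho> > 0"
    "\<And>q. q \<in> frontier D \<Longrightarrow> dist p q < r \<Longrightarrow> \<exists>c. dist q c = \<rho> \<and> cball c \<rho> \<inter> D = {}"
proof -
  obtain U and \<psi> :: "complex \<Rightarrow> real" where U: "open U" "p \<in> U" and C2: "C2_on U \<psi>"
    and neg: "U \<inter> D = {x \<in> U. \<psi> x < 0}" and zer: "U \<inter> frontier D = {x \<in> U. \<psi> x = 0}"
    and reg: "\<And>x. x \<in> U \<inter> frontier D \<Longrightarrow> frechet_derivative \<psi> (at x) \<noteq> (\<lambda>_. 0)"
    and p: "p \<in> frontier D"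
    using assms unfolding C2_boundary_point_def by blast
  obtain L :: "complex \<Rightarrow> complex \<Rightarrow>\<^sub>L real" and M s where s: "s > 0" and M: "M > 0" and sU: "ball p s \<subseteq> U"
    and contL: "continuous_on (ball p s) L"
    and L: "\<And>x. x \<in> ball p s \<Longrightarrow> (\<psi> has_derivative blinfun_apply (L x)) (at x)"
    and Taylor: "\<And>x q. x \<in> ball p s \<Longrightarrow> q \<in> ball p s \<Longrightarrow>
       norm (\<psi> x - \<psi> q - blinfun_apply (L q) (x - q)) \<le> M * (norm (x - q))\<^sup>2"
    using C2_on_Taylor_bound[OF C2 U] by metis
  define m where "m = norm (L p) / 2"
  have "L p \<noteq> 0"
  proof
    assume "L p = 0"
    then have "frechet_derivative \<psi> (at p) = (\<lambda>_. 0)"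
      using frechet_derivative_at[OF L[of p]] s by (auto simp: zero_blinfun.rep_eq)
    then show False using reg U p by blast
  qed
  then have m: "m > 0" "m < norm (L p)" by (auto simp: m_def)
  have "isCont L p" using contL s continuous_on_eq_continuous_at by (metis centre_in_ball open_ball)
  then have "((\<lambda>x. norm (L x)) \<longlongrightarrow> norm (L p)) (nhds p)"
    by (intro tendsto_norm) (simp add: continuous_at tendsto_at_iff_tendsto_nhds)
  then have "\<forall>\<^sub>F x in nhds p. m < norm (L x)"
    by (rule order_tendstoD) (rule m)
  then obtain s' where s': "s' > 0" "\<And>x. dist x p < s' \<Longrightarrow> m < norm (L x)"
    unfolding eventually_nhds_metric by blast
  \<comment> \<open>With these choices the disc at \<open>q\<close> has points at distance below
    \<open>s / 2 + s / 4 < s\<close> from \<open>p\<close>, where the Taylor bound holds, and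
    \<open>2 * M * \<rho> \<le> m\<close> lets the gradient absorb the remainder.\<close>
  define r where "r = min s' (s / 2)"
  define \<rho> where "\<rho> = min (s / 8) (m / (2 * M))"
  have r: "r > 0" and rho: "\<rho> > 0" using s s' m M by (auto simp: r_def \<rho>_def)
  show ?thesis
  proof (rule that[OF r rho])
    fix q assume q: "q \<in> frontier D" "dist p q < r"
    then have qs: "q \<in> ball p s" using s by (auto simp: r_def)
    have psi_q: "\<psi> q = 0" using zer q qs sU by blast
    obtain n where n: "norm n = 1" "\<And>v. blinfun_apply (L q) v = norm (L q) * (n \<bullet> v)"
      using linear_functional_direction by metis
    define c where "c = q + \<rho> *\<^sub>R n"
    have "x \<notin> D" if x: "x \<in> cball c \<rho>" for x
    proof -
      have "dist x q \<le> dist x c + dist c q" by (rule dist_triangle)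
      also have "\<dots> \<le> 2 * \<rho>" using x rho n(1) by (simp add: c_def dist_norm norm_minus_commute)
      finally have "dist x q \<le> s / 4" by (auto simp: \<rho>_def)
      then have "dist p x < s"
        using dist_triangle[of p x q] q s by (auto simp: r_def dist_commute)
      then have xs: "x \<in> ball p s" by simp
      have "(norm (x - q - \<rho> *\<^sub>R n))\<^sup>2 \<le> \<rho>\<^sup>2"
        using x rho by (intro power_mono) (auto simp: c_def dist_norm norm_minus_commute algebra_simps)
      \<comment> \<open>Expanding the square cancels \<open>\<rho>\<^sup>2\<close>, because the
        circle passes through \<open>q\<close>. The squared distance to \<open>q\<close> is thus
        controlled by the normal component.\<close>
      then have inn: "(norm (x - q))\<^sup>2 \<le> 2 * \<rho> * (n \<bullet> (x - q))"
        using n(1) dot_norm_neg[of "x - q" "\<rho> *\<^sub>R n"] by (simp add: power_mult_distrib inner_commute[of n])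
      have nn: "n \<bullet> (x - q) \<ge> 0"
        using order_trans[OF zero_le_power2 inn] rho by (simp add: zero_le_mult_iff)
      have "M * (norm (x - q))\<^sup>2 \<le> M * (2 * \<rho> * (n \<bullet> (x - q)))"
        using inn M by simp
      also have "\<dots> = (2 * M * \<rho>) * (n \<bullet> (x - q))" by simp
      also have "\<dots> \<le> m * (n \<bullet> (x - q))"
        using nn M by (intro mult_right_mono) (auto simp: \<rho>_def min_def field_simps)
      also have "\<dots> \<le> norm (L q) * (n \<bullet> (x - q))"
        using nn s'(2)[of q] q by (intro mult_right_mono) (auto simp: r_def dist_commute)
      finally have "\<psi> x \<ge> 0"
        using Taylor[OF xs qs] psi_q n(2)[of "x - q"] by (simp add: abs_le_iff)
      then show ?thesis using neg xs sU by force
    qed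
    moreover have "dist q c = \<rho>" using n rho by (simp add: c_def dist_norm)
    ultimately show "\<exists>c. dist q c = \<rho> \<and> cball c \<rho> \<inter> D = {}" by blast
  qed
qed

theorem theorem1p4:
  fixes D :: "complex set"
  assumes "planar_domain D" and "bounded D"
  shows "continuous_on D (hurwitz_density D) \<and>
    (\<forall>p. C2_boundary_point D p \<longrightarrow>
      (\<exists>V (C::real). open V \<and> p \<in> V \<and> C > 1 \<and>
        (\<forall>z \<in> V \<inter> D.
           1 / C \<le> hurwitz_density D z * infdist z (frontier D) \<and>
           hurwitz_density D z * infdist z (frontier D) \<le> C)))"
proof (intro conjI allI impI)
  have D: "open D" using assms by (simp add: planar_domain_def)
  show "continuous_on D (hurwitz_density D)"
    using continuous_on_hurwitz_density[OF D assms(2)] .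
  fix p assume p: "C2_boundary_point D p"
  then have pf: "p \<in> frontier D" by (simp add: C2_boundary_point_def)
  obtain r \<rho> where r: "r > 0" and rho: "\<rho> > 0"
    and ext: "\<And>q. q \<in> frontier D \<Longrightarrow> dist p q < r \<Longrightarrow> \<exists>c. dist q c = \<rho> \<and> cball c \<rho> \<inter> D = {}"
    using C2_boundary_point_exterior_disc[OF p] by metis
  \<comment> \<open>The bound \<open>r / 2\<close> keeps a nearest frontier point within
    \<open>r\<close> of \<open>p\<close>; the bound \<open>\<rho>\<close> gives
    \<open>\<delta> + 2 * \<rho> \<le> 3 * \<rho>\<close>, the source of the constant 3.\<close>
  define s where "s = min (r / 2) \<rho>"
  have "1 / 3 \<le> hurwitz_density D z * infdist z (frontier D) \<and>
        hurwitz_density D z * infdist z (frontier D) \<le> 3" if z: "z \<in> ball p s \<inter> D" for z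
  proof -
    define \<delta> where "\<delta> = infdist z (frontier D)"
    have zD: "z \<in> D" and zp: "dist p z < s" using z by auto
    obtain q where q: "q \<in> frontier D" "\<delta> = dist z q"
      using infdist_attains_inf[of "frontier D" z] pf by (auto simp: \<delta>_def)
    have "z \<notin> frontier D" using zD D by (auto simp: frontier_def interior_open)
    then have d0: "\<delta> > 0" using q by auto
    have ds: "\<delta> < s" using infdist_le[OF pf, of z] zp by (simp add: \<delta>_def dist_commute)
    then have "dist p q < r" using dist_triangle[of p q z] zp q by (simp add: s_def)
    then obtain c where c: "dist q c = \<rho>" "cball c \<rho> \<inter> D = {}" using ext q by blast
    \<comment> \<open>Since \<open>q\<close> is a nearest frontier point and lies on the circle
      about \<open>c\<close>, the path through \<open>q\<close> has length
      \<open>\<delta> + \<rho>\<close>. Subtracting \<open>\<rho>\<^sup>2\<close> leaves a quantity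
      linear in \<open>\<delta>\<close> up to a bounded factor.\<close>
    have "(dist z c)\<^sup>2 \<le> (\<delta> + \<rho>)\<^sup>2"
      using dist_triangle[of z c q] c q by (intro power_mono) auto
    then have "(dist z c)\<^sup>2 - \<rho>\<^sup>2 \<le> (\<delta> + 2 * \<rho>) * \<delta>"
      by (simp add: power2_eq_square algebra_simps)
    also have "\<dots> \<le> (3 * \<rho>) * \<delta>" using ds d0 by (intro mult_right_mono) (auto simp: s_def)
    finally have "((dist z c)\<^sup>2 - \<rho>\<^sup>2) / \<rho> \<le> 3 * \<delta>" using rho by (simp add: field_simps)
    with hurwitz_radius_le_exterior_disc[OF D zD rho c(2)]
    have up: "hurwitz_radius D z \<le> 3 * \<delta>" by linarith
    have "\<delta> \<le> hurwitz_radius D z"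
      using inradius_le_hurwitz_radius[OF assms(2) d0] ball_infdist_frontier_subset[OF zD]
      by (simp add: \<delta>_def)
    with up d0 show ?thesis
      by (simp add: hurwitz_density_def field_simps flip: \<delta>_def)
  qed
  then show "\<exists>V (C::real). open V \<and> p \<in> V \<and> C > 1 \<and>
        (\<forall>z \<in> V \<inter> D.
           1 / C \<le> hurwitz_density D z * infdist z (frontier D) \<and>
           hurwitz_density D z * infdist z (frontier D) \<le> C)"
    using r rho by (intro exI[of _ "ball p s"] exI[of _ 3]) (auto simp: s_def)
qed

end
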